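(* Let $e : X \to Y$ be a compactification of a completely regular space $X$. Then the associated de Vries extension $e^{-1} : \mathcal{RO}(Y) \to \wp(X)$ is normal if and only if $X$ is normal and $e$ is isomorphic, in the category $\mathsf{Comp}$, to the Stone-Čech compactification $s : X \to \beta X$ of $X$. In particular, $X$ is normal if and only if $s^{-1} : \mathcal{RO}(\beta X) \to \wp(X)$ is a normal de Vries extension.
   Context: Completely regular spaces are assumed Hausdorff. A compactification $e:X\to Y$ is a topological embedding of $X$ onto a dense subspace of a compact Hausdorff space $Y$. The category $\mathsf{Comp}$ has as objects compactifications $e:X\to Y$ and as morphisms from $e:X\to Y$ to $e':X'\to Y'$ pairs $(f,g)$ of continuous maps $f:X\to X'$, $g:Y\to Y'$ with $g\circ e=e'\circ f$ (composition is componentwise); so $e$ and $e'$ are isomorphic iff there is such a pair with $f,g$ homeomorphisms. A de Vries algebra is a pair $\mathfrak A=(A,\prec)$, where $A$ is a complete Boolean algebra and $\prec$ is a binary relation on $A$ with: (DV1) $1\prec 1$; (DV2) $a\prec b$ implies $a\le b$; (DV3) $a\le b\prec c\le d$ implies $a\prec d$; (DV4) $a\prec b,c$ implies $a\prec b\wedge c$; (DV5) $a\prec b$ implies $\neg b\prec\neg a$; (DV6) $a\prec b$ implies there is $c$ with $a\prec c\prec b$; (DV7) $b=\bigvee\{a\in A\mid a\prec b\}$. A de Vries morphism $\rho:\mathfrak A\to\mathfrak B$ is a map with: (M1) $\rho(0)=0$; (M2) $\rho(a\wedge b)=\rho(a)\wedge\rho(b)$; (M3) $a\prec b$ implies $\neg\rho(\neg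 a)\prec\rho(b)$; (M4) $\rho(b)=\bigvee\{\rho(a)\mid a\prec b\}$. A de Vries algebra is extremally disconnected if $a\prec b$ iff $a\le b$, and atomic if $A$ is an atomic Boolean algebra. A de Vries extension is a one-to-one de Vries morphism $\alpha:\mathfrak A\to\mathfrak B$ with $\mathfrak B$ atomic and extremally disconnected such that every element of $\mathfrak B$ is a join of meets of elements of $\alpha[\mathfrak A]$. A filter $F$ of $\mathfrak A$ is round if for each $b\in F$ there is $a\in F$ with $a\prec b$; an ideal $I$ is round if for each $a\in I$ there is $b\in I$ with $a\prec b$. A de Vries extension $\alpha:\mathfrak A\to\mathfrak B$ is normal if: whenever $F$ is a round filter and $I$ a round ideal of $\mathfrak A$ with $\bigwedge\alpha[F]\le\bigvee\alpha[I]$, there are $a,b\in\mathfrak A$ such that $a\prec b$, $\bigwedge\alpha[F]\le\alpha(a)$, and $\alpha(b)\le\bigvee\alpha[I]$. For a compactification $e:X\to Y$, $\mathcal{RO}(Y)$ is the complete Boolean algebra of regular open subsets of $Y$ with $U\prec V$ iff $\mathrm{cl}(U)\subseteq V$ (a de Vries algebra), and $\wp(X)$ is the powerset of $X$ with relation $\subseteq$ (an atomic extremally disconnected de Vries algebra); the associated de Vries extension is $U\mapsto e^{-1}(U)$ (it is a known fact that this is a de Vries extension). *)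

theory Defs
  imports "HOL-Analysis.Analysis" "HOL-Algebra.Complete_Lattice"
begin

no_notation lesspoll (infixl \<open>\<prec>\<close> 50)

section \<open>De Vries algebras\<close>

locale complete_boolean_lattice = Complete_Lattice.complete_lattice L for L (structure) +
  assumes meet_join_distrib:
      "\<lbrakk>x \<in> carrier L; y \<in> carrier L; z \<in> carrier L\<rbrakk> \<Longrightarrow> x \<sqinter> (y \<squnion> z) = (x \<sqinter> y) \<squnion> (x \<sqinter> z)"
    and complement_exists:
      "x \<in> carrier L \<Longrightarrow> \<exists>y\<in>carrier L. x \<sqinter> y = \<bottom> \<and> x \<squnion> y = \<top>"

definition complement :: "('a, 'm) gorder_scheme \<Rightarrow> 'a \<Rightarrow> 'a" (\<open>\<sim>\<index> _\<close> [81] 80)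
  where "\<sim>\<^bsub>L\<^esub> x =
    (THE y. y \<in> carrier L \<and> x \<sqinter>\<^bsub>L\<^esub> y = \<bottom>\<^bsub>L\<^esub> \<and> x \<squnion>\<^bsub>L\<^esub> y = \<top>\<^bsub>L\<^esub>)"

definition atom :: "('a, 'm) gorder_scheme \<Rightarrow> 'a \<Rightarrow> bool"
  where "atom L a \<longleftrightarrow> a \<in> carrier L \<and> a \<noteq> \<bottom>\<^bsub>L\<^esub> \<and>
    (\<forall>x\<in>carrier L. x \<sqsubseteq>\<^bsub>L\<^esub> a \<longrightarrow> x = \<bottom>\<^bsub>L\<^esub> \<or> x = a)"

definition atomic :: "('a, 'm) gorder_scheme \<Rightarrow> bool"
  where "atomic L \<longleftrightarrow>
    (\<forall>x\<in>carrier L. x \<noteq> \<bottom>\<^bsub>L\<^esub> \<longrightarrow> (\<exists>a. atom L a \<and> a \<sqsubseteq>\<^bsub>L\<^esub> x))"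

record 'a proximity_order = "'a gorder" +
  prec :: "'a \<Rightarrow> 'a \<Rightarrow> bool" (infixl \<open>\<prec>\<index>\<close> 50)

locale de_vries_algebra = complete_boolean_lattice A for A (structure) +
  assumes DV1: "\<top> \<prec> \<top>"
    and DV2: "\<lbrakk>a \<in> carrier A; b \<in> carrier A; a \<prec> b\<rbrakk> \<Longrightarrow> a \<sqsubseteq> b"
    and DV3: "\<lbrakk>a \<in> carrier A; b \<in> carrier A; c \<in> carrier A; d \<in> carrier A;
               a \<sqsubseteq> b; b \<prec> c; c \<sqsubseteq> d\<rbrakk> \<Longrightarrow> a \<prec> d"
    and DV4: "\<lbrakk>a \<in> carrier A; b \<in> carrier A; c \<in> carrier A; a \<prec> b; a \<prec> c\<rbrakk> \<Longrightarrow> a \<prec> b \<sqinter> c"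
    and DV5: "\<lbrakk>a \<in> carrier A; b \<in> carrier A; a \<prec> b\<rbrakk> \<Longrightarrow> \<sim> b \<prec> \<sim> a"
    and DV6: "\<lbrakk>a \<in> carrier A; b \<in> carrier A; a \<prec> b\<rbrakk> \<Longrightarrow> \<exists>c\<in>carrier A. a \<prec> c \<and> c \<prec> b"
    and DV7: "b \<in> carrier A \<Longrightarrow> b = \<Squnion>{a \<in> carrier A. a \<prec> b}"

definition extremally_disconnected :: "('a, 'm) proximity_order_scheme \<Rightarrow> bool"
  where "extremally_disconnected A \<longleftrightarrow>
    (\<forall>a\<in>carrier A. \<forall>b\<in>carrier A. a \<prec>\<^bsub>A\<^esub> b \<longleftrightarrow> a \<sqsubseteq>\<^bsub>A\<^esub> b)"

locale de_vries_morphism =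
  A?: de_vries_algebra A + B?: de_vries_algebra B
  for A (structure) and B (structure) and \<rho> +
  assumes maps: "\<rho> \<in> carrier A \<rightarrow> carrier B"
    and M1: "\<rho> \<bottom>\<^bsub>A\<^esub> = \<bottom>\<^bsub>B\<^esub>"
    and M2: "\<lbrakk>a \<in> carrier A; b \<in> carrier A\<rbrakk> \<Longrightarrow> \<rho> (a \<sqinter>\<^bsub>A\<^esub> b) = \<rho> a \<sqinter>\<^bsub>B\<^esub> \<rho> b"
    and M3: "\<lbrakk>a \<in> carrier A; b \<in> carrier A; a \<prec>\<^bsub>A\<^esub> b\<rbrakk>
               \<Longrightarrow> \<sim>\<^bsub>B\<^esub> (\<rho> (\<sim>\<^bsub>A\<^esub> a)) \<prec>\<^bsub>B\<^esub> \<rho> b"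
    and M4: "b \<in> carrier A \<Longrightarrow> \<rho> b = \<Squnion>\<^bsub>B\<^esub>(\<rho> ` {a \<in> carrier A. a \<prec>\<^bsub>A\<^esub> b})"

section \<open>De Vries extensions and normality\<close>

locale de_vries_extension = de_vries_morphism A B \<alpha>
  for A (structure) and B (structure) and \<alpha> +
  assumes one_to_one: "inj_on \<alpha> (carrier A)"
    and atomic_codomain: "atomic B"
    and extremally_disconnected_codomain: "extremally_disconnected B"
    and join_of_meets: "b \<in> carrier B \<Longrightarrow>
      \<exists>\<M>. \<M> \<subseteq> Pow (\<alpha> ` carrier A) \<and> b = \<Squnion>\<^bsub>B\<^esub>((\<lambda>M. \<Sqinter>\<^bsub>B\<^esub>M) ` \<M>)"

text \<open>Filters and ideals are nonempty, but not required to be proper.\<close>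

definition round_filter :: "('a, 'm) proximity_order_scheme \<Rightarrow> 'a set \<Rightarrow> bool"
  where "round_filter A F \<longleftrightarrow> F \<subseteq> carrier A \<and> F \<noteq> {} \<and>
    (\<forall>a\<in>F. \<forall>b\<in>F. a \<sqinter>\<^bsub>A\<^esub> b \<in> F) \<and>
    (\<forall>a\<in>F. \<forall>b\<in>carrier A. a \<sqsubseteq>\<^bsub>A\<^esub> b \<longrightarrow> b \<in> F) \<and>
    (\<forall>b\<in>F. \<exists>a\<in>F. a \<prec>\<^bsub>A\<^esub> b)"

definition round_ideal :: "('a, 'm) proximity_order_scheme \<Rightarrow> 'a set \<Rightarrow> bool"
  where "round_ideal A I \<longleftrightarrow> I \<subseteq> carrier A \<and> I \<noteq> {} \<and>
    (\<forall>a\<in>I. \<forall>b\<in>I. a \<squnion>\<^bsub>A\<^esub> b \<in> I) \<and>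
    (\<forall>a\<in>I. \<forall>b\<in>carrier A. b \<sqsubseteq>\<^bsub>A\<^esub> a \<longrightarrow> b \<in> I) \<and>
    (\<forall>a\<in>I. \<exists>b\<in>I. a \<prec>\<^bsub>A\<^esub> b)"

locale normal_de_vries_extension = de_vries_extension +
  assumes normal: "\<lbrakk>round_filter A F; round_ideal A I;
      \<Sqinter>\<^bsub>B\<^esub>(\<alpha> ` F) \<sqsubseteq>\<^bsub>B\<^esub> \<Squnion>\<^bsub>B\<^esub>(\<alpha> ` I)\<rbrakk>
    \<Longrightarrow> \<exists>a\<in>carrier A. \<exists>b\<in>carrier A. a \<prec>\<^bsub>A\<^esub> b \<and>
          \<Sqinter>\<^bsub>B\<^esub>(\<alpha> ` F) \<sqsubseteq>\<^bsub>B\<^esub> \<alpha> a \<and> \<alpha> b \<sqsubseteq>\<^bsub>B\<^esub> \<Squnion>\<^bsub>B\<^esub>(\<alpha> ` I)"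

section \<open>Compactifications\<close>

definition compactification :: "'a topology \<Rightarrow> 'b topology \<Rightarrow> ('a \<Rightarrow> 'b) \<Rightarrow> bool"
  where "compactification X Y e \<longleftrightarrow> compact_space Y \<and> Hausdorff_space Y \<and>
    embedding_map X Y e \<and> Y closure_of (e ` topspace X) = topspace Y"

definition Comp_morphism ::
    "'a topology \<Rightarrow> 'b topology \<Rightarrow> ('a \<Rightarrow> 'b) \<Rightarrow> 'c topology \<Rightarrow> 'd topology \<Rightarrow> ('c \<Rightarrow> 'd)
      \<Rightarrow> ('a \<Rightarrow> 'c) \<Rightarrow> ('b \<Rightarrow> 'd) \<Rightarrow> bool"
  where "Comp_morphism X Y e X' Y' e' f g \<longleftrightarrow>
    continuous_map X X' f \<and> continuous_map Y Y' g \<and> (\<forall>x\<in>topspace X. g (e x) = e' (f x))"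

definition Comp_isomorphic ::
    "'a topology \<Rightarrow> 'b topology \<Rightarrow> ('a \<Rightarrow> 'b) \<Rightarrow> 'c topology \<Rightarrow> 'd topology \<Rightarrow> ('c \<Rightarrow> 'd) \<Rightarrow> bool"
  where "Comp_isomorphic X Y e X' Y' e' \<longleftrightarrow>
    (\<exists>f g. Comp_morphism X Y e X' Y' e' f g \<and> homeomorphic_map X X' f \<and> homeomorphic_map Y Y' g)"

definition regular_open_algebra :: "'a topology \<Rightarrow> 'a set proximity_order" (\<open>\<R>\<O>\<close>)
  where "\<R>\<O> Y =
    \<lparr> carrier = {U. openin Y U \<and> Y interior_of (Y closure_of U) = U}, eq = (=), le = (\<subseteq>),
      prec = (\<lambda>U V. Y closure_of U \<subseteq> V) \<rparr>"

definition powerset_algebra :: "'a set \<Rightarrow> 'a set proximity_order" (\<open>\<wp>\<close>)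
  where "\<wp> S = \<lparr> carrier = Pow S, eq = (=), le = (\<subseteq>), prec = (\<subseteq>) \<rparr>"

definition preimage_map :: "'a topology \<Rightarrow> ('a \<Rightarrow> 'b) \<Rightarrow> 'b set \<Rightarrow> 'a set"
  where "preimage_map X e U = {x \<in> topspace X. e x \<in> U}"

section \<open>The Stone-Cech compactification\<close>

text \<open>
  The standard construction: evaluation embeds \<open>X\<close> into the cube whose coordinates are the
  continuous functions \<open>X \<rightarrow> [0,1]\<close>, and \<open>\<beta> X\<close> is the closure of the image. Restricting to
  extensional functions gives exactly one coordinate for each function on \<open>topspace X\<close>.
\<close>

definition unit_interval_maps :: "'a topology \<Rightarrow> ('a \<Rightarrow> real) set"
  where "unit_interval_maps X =
    {f \<in> extensional (topspace X). continuous_map X (top_of_set {0..1}) f}"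

definition stone_cech_cube :: "'a topology \<Rightarrow> (('a \<Rightarrow> real) \<Rightarrow> real) topology"
  where "stone_cech_cube X = product_topology (\<lambda>_. top_of_set {0..1}) (unit_interval_maps X)"

definition stone_cech_map :: "'a topology \<Rightarrow> 'a \<Rightarrow> ('a \<Rightarrow> real) \<Rightarrow> real"
  where "stone_cech_map X x = (\<lambda>f\<in>unit_interval_maps X. f x)"

definition stone_cech :: "'a topology \<Rightarrow> (('a \<Rightarrow> real) \<Rightarrow> real) topology" (\<open>\<beta>\<close>)
  where "\<beta> X = subtopology (stone_cech_cube X)
    (stone_cech_cube X closure_of (stone_cech_map X ` topspace X))"

end

theory Submission
  imports Defs
begin

text \<open>
  Write \<open>e : X \<rightarrow> Y\<close> for a compactification. The round filters of \<open>\<R>\<O> Y\<close> represent the closed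
  subsets of \<open>Y\<close>, and the round ideals the open ones: a round filter \<open>F\<close> has the closed intersection
  \<open>\<Inter>F = \<Inter>(cl ` F)\<close>, every closed \<open>C\<close> is the intersection of the round filter of its regular open
  neighbourhoods, and dually for ideals and open sets. In the powerset of \<open>X\<close> meets and joins
  are intersections and unions, so normality of the extension \<open>U \<mapsto> e\<^sup>-\<^sup>1(U)\<close> says: if \<open>C\<close> is closed
  and \<open>U\<close> is open in \<open>Y\<close>, and \<open>C\<close> lies in \<open>U\<close> as far as points of \<open>X\<close> can tell, then a pair
  \<open>a \<prec> b\<close> of regular open sets fits in between, again as far as points of \<open>X\<close> can tell. Since \<open>Y\<close> is a
  normal space, this amounts to a property of \<open>e\<close> alone, \<open>separates_closed_sets\<close>: disjoint
  closed subsets of \<open>X\<close> have disjoint closures in \<open>Y\<close> (\<open>normal_extension_iff_separates\<close>).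

  Such an \<open>e\<close> makes \<open>X\<close> normal, because the disjoint closures can be separated by open sets in \<open>Y\<close>.
  If conversely \<open>X\<close> is normal, then \<open>X \<rightarrow> \<beta> X\<close> separates closed sets: a Urysohn function is one of the
  coordinates of \<open>\<beta> X\<close>, so it is defined on all of \<open>\<beta> X\<close>, and it takes the value 0 on
  the closure of the first set and 1 on the closure of the second.

  It remains to see that a space has, up to isomorphism, at most one compactification that
  separates closed sets. This is Taimanov's extension argument (\<open>separates_imp_extends\<close>): for a
  continuous \<open>f : X \<rightarrow> K\<close> into a compact Hausdorff space, the closure of \<open>{(e x, f x)}\<close> in \<open>Y \<times> K\<close> is the
  graph of a continuous function. Applied to two compactifications in both directions it yields
  maps that are inverse to each other on the dense copies of \<open>X\<close>, hence everywhere.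
\<close>

(* Closure under an equivalence and topological closure share the name closure_of; only the latter
   is used here, and its terms would otherwise have several parses. *)
no_notation eq_closure_of (\<open>closure'_of\<index>\<close>)

section \<open>Families of sets ordered by inclusion\<close>

text \<open>
  Both algebras of interest are sets of sets ordered by inclusion. Suprema and infima are Hilbert
  choices over bounds; the rules of this locale compute them from a concrete candidate.
\<close>

locale inclusion_order =
  fixes L :: "('a set, 'm) gorder_scheme" (structure)
  assumes eq_eq: "eq L = (=)" and le_subset: "le L = (\<subseteq>)"
begin

lemma partial_order: "partial_order L"
  by unfold_locales (auto simp: eq_eq le_subset)

lemma least_Upper_iff:
  assumes "S \<subseteq> carrier L"
  shows "least L s (Upper L S) \<longleftrightarrow>
    s \<in> carrier L \<and> \<Union>S \<subseteq> s \<and> (\<forall>u\<in>carrier L. \<Union>S \<subseteq> u \<longrightarrow> s \<subseteq> u)"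
proof -
  have "Upper L S = {u \<in> carrier L. \<Union>S \<subseteq> u}"
    using assms unfolding Upper_def le_subset by blast
  then show ?thesis
    unfolding least_def le_subset by (simp add: Ball_def imp_conjL del: Sup_le_iff)
qed

lemma greatest_Lower_iff:
  assumes "S \<subseteq> carrier L"
  shows "greatest L s (Lower L S) \<longleftrightarrow>
    s \<in> carrier L \<and> s \<subseteq> \<Inter>S \<and> (\<forall>u\<in>carrier L. u \<subseteq> \<Inter>S \<longrightarrow> u \<subseteq> s)"
proof -
  have "Lower L S = {u \<in> carrier L. u \<subseteq> \<Inter>S}"
    using assms unfolding Lower_def le_subset le_Inf_iff by blast
  then show ?thesis
    unfolding greatest_def le_subset by (simp add: Ball_def imp_conjL del: le_Inf_iff)
qed

lemma sup_eqI:
  assumes "S \<subseteq> carrier L" "s \<in> carrier L" "\<Union>S \<subseteq> s"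
    and "\<And>u. u \<in> carrier L \<Longrightarrow> \<Union>S \<subseteq> u \<Longrightarrow> s \<subseteq> u"
  shows "\<Squnion>S = s"
proof -
  have *: "least L s (Upper L S)"
    unfolding least_Upper_iff[OF assms(1)] using assms by blast
  have "least L (\<Squnion>S) (Upper L S)"
    unfolding sup_def using * by (rule someI)
  then show ?thesis
    using * by (rule partial_order.least_unique[OF partial_order])
qed

lemma inf_eqI:
  assumes "S \<subseteq> carrier L" "s \<in> carrier L" "s \<subseteq> \<Inter>S"
    and "\<And>u. u \<in> carrier L \<Longrightarrow> u \<subseteq> \<Inter>S \<Longrightarrow> u \<subseteq> s"
  shows "\<Sqinter>S = s"
proof -
  have *: "greatest L s (Lower L S)"
    unfolding greatest_Lower_iff[OF assms(1)] using assms by blast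
  have "greatest L (\<Sqinter>S) (Lower L S)"
    unfolding inf_def using * by (rule someI)
  then show ?thesis
    using * by (rule partial_order.greatest_unique[OF partial_order])
qed

lemma bottom_eqI:
  assumes "s \<in> carrier L" "\<And>u. u \<in> carrier L \<Longrightarrow> s \<subseteq> u"
  shows "\<bottom> = s"
proof -
  have *: "least L s (carrier L)"
    using assms by (auto simp: least_def le_subset)
  have "least L (\<bottom>) (carrier L)"
    unfolding bottom_def using * by (rule someI)
  then show ?thesis
    using * by (rule partial_order.least_unique[OF partial_order])
qed

lemma top_eqI:
  assumes "s \<in> carrier L" "\<And>u. u \<in> carrier L \<Longrightarrow> u \<subseteq> s"
  shows "\<top> = s"
proof -
  have *: "greatest L s (carrier L)"
    using assms by (auto simp: greatest_def le_subset)
  have "greatest L (\<top>) (carrier L)"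
    unfolding top_def using * by (rule someI)
  then show ?thesis
    using * by (rule partial_order.greatest_unique[OF partial_order])
qed

end

section \<open>The de Vries algebra of a powerset\<close>

lemma powerset_simps [simp]:
  "carrier (\<wp> S) = Pow S" "eq (\<wp> S) = (=)" "le (\<wp> S) = (\<subseteq>)" "prec (\<wp> S) = (\<subseteq>)"
  by (simp_all add: powerset_algebra_def)

interpretation powerset: inclusion_order "\<wp> S" for S
  by unfold_locales simp_all

lemma powerset_sup: "\<A> \<subseteq> Pow S \<Longrightarrow> \<Squnion>\<^bsub>\<wp> S\<^esub> \<A> = \<Union>\<A>"
  by (rule powerset.sup_eqI) auto

lemma powerset_inf: "\<A> \<subseteq> Pow S \<Longrightarrow> \<Sqinter>\<^bsub>\<wp> S\<^esub> \<A> = S \<inter> \<Inter>\<A>"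
  by (rule powerset.inf_eqI) (simp_all add: le_Inf_iff, blast)

lemma powerset_join [simp]: "A \<subseteq> S \<Longrightarrow> B \<subseteq> S \<Longrightarrow> A \<squnion>\<^bsub>\<wp> S\<^esub> B = A \<union> B"
  by (simp add: join_def powerset_sup)

lemma powerset_meet [simp]: "A \<subseteq> S \<Longrightarrow> B \<subseteq> S \<Longrightarrow> A \<sqinter>\<^bsub>\<wp> S\<^esub> B = A \<inter> B"
  by (auto simp add: meet_def powerset_inf)

lemma powerset_bottom [simp]: "\<bottom>\<^bsub>\<wp> S\<^esub> = {}"
  by (rule powerset.bottom_eqI) auto

lemma powerset_top [simp]: "\<top>\<^bsub>\<wp> S\<^esub> = S"
  by (rule powerset.top_eqI) auto

lemma powerset_complement [simp]: "A \<subseteq> S \<Longrightarrow> \<sim>\<^bsub>\<wp> S\<^esub> A = S - A"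
proof -
  assume "A \<subseteq> S"
  moreover from this have "B = S - A" if "B \<subseteq> S" "A \<inter> B = {}" "A \<union> B = S" for B
    using that by blast
  ultimately show ?thesis
    unfolding complement_def by (intro the_equality) auto
qed

lemma de_vries_algebra_powerset: "de_vries_algebra (\<wp> S)"
proof -
  interpret partial_order "\<wp> S"
    by (rule powerset.partial_order)
  show ?thesis
  proof unfold_locales
    fix \<A> assume "\<A> \<subseteq> carrier (\<wp> S)"
    then show "\<exists>s. is_lub (\<wp> S) s \<A>"
      by (intro exI[of _ "\<Union>\<A>"]) (subst powerset.least_Upper_iff, auto)
  next
    fix \<A> assume "\<A> \<subseteq> carrier (\<wp> S)"
    then show "\<exists>s. is_glb (\<wp> S) s \<A>"
      by (intro exI[of _ "S \<inter> \<Inter>\<A>"]) (subst powerset.greatest_Lower_iff, auto)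
  next
    fix A B C assume "A \<in> carrier (\<wp> S)" "B \<in> carrier (\<wp> S)" "C \<in> carrier (\<wp> S)"
    then have "A \<subseteq> S" "B \<subseteq> S" "C \<subseteq> S"
      by auto
    moreover from this have "B \<union> C \<subseteq> S" "A \<inter> B \<subseteq> S" "A \<inter> C \<subseteq> S"
      by auto
    ultimately show "A \<sqinter>\<^bsub>\<wp> S\<^esub> (B \<squnion>\<^bsub>\<wp> S\<^esub> C) = A \<sqinter>\<^bsub>\<wp> S\<^esub> B \<squnion>\<^bsub>\<wp> S\<^esub> (A \<sqinter>\<^bsub>\<wp> S\<^esub> C)"
      by auto
  next
    fix A assume "A \<in> carrier (\<wp> S)"
    then show "\<exists>B\<in>carrier (\<wp> S). A \<sqinter>\<^bsub>\<wp> S\<^esub> B = \<bottom>\<^bsub>\<wp> S\<^esub> \<and> A \<squnion>\<^bsub>\<wp> S\<^esub> B = \<top>\<^bsub>\<wp> S\<^esub>"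
      by (intro bexI[of _ "S - A"]) auto
  next
    fix B assume "B \<in> carrier (\<wp> S)"
    then show "B = \<Squnion>\<^bsub>\<wp> S\<^esub>{A \<in> carrier (\<wp> S). A \<prec>\<^bsub>\<wp> S\<^esub> B}"
      by (subst powerset_sup) auto
  next
    fix A B assume "A \<in> carrier (\<wp> S)" "B \<in> carrier (\<wp> S)" "A \<prec>\<^bsub>\<wp> S\<^esub> B"
    then show "\<exists>C\<in>carrier (\<wp> S). A \<prec>\<^bsub>\<wp> S\<^esub> C \<and> C \<prec>\<^bsub>\<wp> S\<^esub> B"
      by (intro bexI[of _ A]) simp_all
  qed (simp_all, blast?)
qed

section \<open>The de Vries algebra of regular open sets\<close>

lemma regular_open_simps [simp]:
  "eq (\<R>\<O> Y) = (=)" "le (\<R>\<O> Y) = (\<subseteq>)" "prec (\<R>\<O> Y) = (\<lambda>U V. Y closure_of U \<subseteq> V)"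
  by (simp_all add: regular_open_algebra_def)

lemma in_regular_open_iff:
  "U \<in> carrier (\<R>\<O> Y) \<longleftrightarrow> openin Y U \<and> Y interior_of (Y closure_of U) = U"
  by (simp add: regular_open_algebra_def)

lemma regular_open_imp_open: "U \<in> carrier (\<R>\<O> Y) \<Longrightarrow> openin Y U"
  by (simp add: in_regular_open_iff)

lemma regular_open_interior_closure [simp]:
  "U \<in> carrier (\<R>\<O> Y) \<Longrightarrow> Y interior_of (Y closure_of U) = U"
  by (simp add: in_regular_open_iff)

lemma regular_open_subset_topspace: "U \<in> carrier (\<R>\<O> Y) \<Longrightarrow> U \<subseteq> topspace Y"
  by (simp add: regular_open_imp_open openin_subset)

text \<open>
  The closure of \<open>int C\<close> stays inside the closed set \<open>C\<close>, so its interior is no larger than \<open>int C\<close>.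
  Interiors of closures and exteriors of open sets are instances.
\<close>

lemma interior_closed_regular_open:
  assumes "closedin Y C"
  shows "Y interior_of C \<in> carrier (\<R>\<O> Y)"
proof -
  have "Y closure_of (Y interior_of C) \<subseteq> C"
    by (simp add: assms closure_of_minimal interior_of_subset)
  moreover have "Y interior_of C \<subseteq> Y closure_of (Y interior_of C)"
    by (simp add: closure_of_subset interior_of_subset_topspace)
  ultimately show ?thesis
    unfolding in_regular_open_iff
    by (metis interior_of_interior_of interior_of_mono openin_interior_of subset_antisym)
qed

lemma interior_closure_regular_open: "Y interior_of (Y closure_of S) \<in> carrier (\<R>\<O> Y)"
  by (simp add: interior_closed_regular_open)

lemma open_subset_interior_closure: "openin Y U \<Longrightarrow> U \<subseteq> Y interior_of (Y closure_of U)"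
  by (simp add: closure_of_subset interior_of_maximal openin_subset)

lemma interior_closure_subset_regular_open:
  assumes "V \<in> carrier (\<R>\<O> Y)" "S \<subseteq> V"
  shows "Y interior_of (Y closure_of S) \<subseteq> V"
  using assms by (metis closure_of_mono interior_of_mono regular_open_interior_closure)

interpretation regular_open: inclusion_order "\<R>\<O> Y" for Y
  by unfold_locales simp_all

lemma regular_open_sup_ex:
  assumes "\<U> \<subseteq> carrier (\<R>\<O> Y)"
  shows "is_lub (\<R>\<O> Y) (Y interior_of (Y closure_of \<Union>\<U>)) \<U>"
  unfolding regular_open.least_Upper_iff[OF assms]
proof (intro conjI ballI impI)
  have "openin Y (\<Union>\<U>)"
    using assms by (intro openin_Union) (auto intro: regular_open_imp_open)
  then show "\<Union>\<U> \<subseteq> Y interior_of (Y closure_of \<Union>\<U>)"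
    by (rule open_subset_interior_closure)
qed (simp_all only: interior_closure_regular_open interior_closure_subset_regular_open)

lemma regular_open_sup:
  assumes "\<U> \<subseteq> carrier (\<R>\<O> Y)"
  shows "\<Squnion>\<^bsub>\<R>\<O> Y\<^esub> \<U> = Y interior_of (Y closure_of \<Union>\<U>)"
  using regular_open_sup_ex[OF assms] assms
  unfolding regular_open.least_Upper_iff[OF assms]
  by (intro regular_open.sup_eqI) blast+

text \<open>
  The interior of an intersection of regular open sets is already regular open: the interior of
  its closure is contained in each member of the family. The intersection with \<open>topspace Y\<close>
  accounts for the empty family.
\<close>

lemma regular_open_inf_ex:
  assumes "\<U> \<subseteq> carrier (\<R>\<O> Y)"
  shows "is_glb (\<R>\<O> Y) (Y interior_of (topspace Y \<inter> \<Inter>\<U>)) \<U>"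
  unfolding regular_open.greatest_Lower_iff[OF assms]
proof (intro conjI ballI impI)
  let ?I = "Y interior_of (topspace Y \<inter> \<Inter>\<U>)"
  have "Y interior_of (Y closure_of ?I) \<subseteq> U" if "U \<in> \<U>" for U
  proof (rule interior_closure_subset_regular_open)
    show "?I \<subseteq> U"
      using that interior_of_subset[of Y "topspace Y \<inter> \<Inter>\<U>"] by blast
  qed (use that assms in blast)
  then have "Y interior_of (Y closure_of ?I) \<subseteq> topspace Y \<inter> \<Inter>\<U>"
    by (simp add: le_Inf_iff interior_of_subset_topspace)
  then have "Y interior_of (Y closure_of ?I) \<subseteq> ?I"
    by (simp add: interior_of_maximal)
  then show "?I \<in> carrier (\<R>\<O> Y)"
    unfolding in_regular_open_iff
    using open_subset_interior_closure[OF openin_interior_of] openin_interior_of by (metis subset_antisym)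
  show "?I \<subseteq> \<Inter>\<U>"
    using interior_of_subset[of Y "topspace Y \<inter> \<Inter>\<U>"] by blast
  fix U assume "U \<in> carrier (\<R>\<O> Y)" "U \<subseteq> \<Inter>\<U>"
  then show "U \<subseteq> ?I"
    by (simp add: interior_of_maximal regular_open_imp_open regular_open_subset_topspace)
qed

lemma regular_open_join:
  assumes "U \<in> carrier (\<R>\<O> Y)" "V \<in> carrier (\<R>\<O> Y)"
  shows "U \<squnion>\<^bsub>\<R>\<O> Y\<^esub> V = Y interior_of (Y closure_of (U \<union> V))"
  unfolding join_def using regular_open_sup[of "{U, V}" Y] assms by simp

lemma regular_open_Int:
  assumes "U \<in> carrier (\<R>\<O> Y)" "V \<in> carrier (\<R>\<O> Y)"
  shows "U \<inter> V \<in> carrier (\<R>\<O> Y)"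
proof -
  have "Y interior_of (Y closure_of (U \<inter> V)) \<subseteq> U \<inter> V"
    using assms interior_closure_subset_regular_open by (metis inf_le1 inf_le2 le_inf_iff)
  then show ?thesis
    unfolding in_regular_open_iff
    using assms open_subset_interior_closure[of Y "U \<inter> V"]
    by (simp only: openin_Int regular_open_imp_open) blast
qed

lemma regular_open_meet:
  assumes "U \<in> carrier (\<R>\<O> Y)" "V \<in> carrier (\<R>\<O> Y)"
  shows "U \<sqinter>\<^bsub>\<R>\<O> Y\<^esub> V = U \<inter> V"
  unfolding meet_def by (rule regular_open.inf_eqI) (use assms regular_open_Int in auto)

lemma empty_regular_open: "{} \<in> carrier (\<R>\<O> Y)"
  by (simp add: in_regular_open_iff)

lemma topspace_regular_open: "topspace Y \<in> carrier (\<R>\<O> Y)"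
  by (simp add: in_regular_open_iff)

lemma regular_open_bottom [simp]: "\<bottom>\<^bsub>\<R>\<O> Y\<^esub> = {}"
  by (rule regular_open.bottom_eqI) (simp_all add: empty_regular_open)

lemma regular_open_top [simp]: "\<top>\<^bsub>\<R>\<O> Y\<^esub> = topspace Y"
  by (rule regular_open.top_eqI) (simp_all add: topspace_regular_open regular_open_subset_topspace)

lemma exterior_regular_open:
  "openin Y U \<Longrightarrow> topspace Y - Y closure_of U \<in> carrier (\<R>\<O> Y)"
  using interior_closed_regular_open[of Y "topspace Y - U"]
  by (simp add: interior_of_complement openin_closedin_eq)

text \<open>
  The two complement laws determine the complement as the exterior. For the harder inclusion, a
  point outside the closure of \<open>U\<close> has a neighbourhood inside the closure of \<open>V\<close>,
  and \<open>V\<close> is the interior of its closure.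
\<close>

lemma regular_open_complement_laws:
  assumes U: "U \<in> carrier (\<R>\<O> Y)" and V: "V \<in> carrier (\<R>\<O> Y)"
  shows "U \<inter> V = {} \<and> Y interior_of (Y closure_of (U \<union> V)) = topspace Y \<longleftrightarrow>
    V = topspace Y - Y closure_of U"
proof
  assume *: "U \<inter> V = {} \<and> Y interior_of (Y closure_of (U \<union> V)) = topspace Y"
  show "V = topspace Y - Y closure_of U"
  proof
    show "V \<subseteq> topspace Y - Y closure_of U"
      using * V openin_Int_closure_of_eq_empty[of Y V U] regular_open_imp_open regular_open_subset_topspace
      by blast
    have "topspace Y \<subseteq> Y closure_of U \<union> Y closure_of V"
      using * interior_of_subset[of Y "Y closure_of (U \<union> V)"] by simp
    then have "topspace Y - Y closure_of U \<subseteq> Y interior_of (Y closure_of V)"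
      by (intro interior_of_maximal) auto
    then show "topspace Y - Y closure_of U \<subseteq> V"
      using V by simp
  qed
next
  assume V_eq: "V = topspace Y - Y closure_of U"
  have sub: "U \<subseteq> Y closure_of U" "V \<subseteq> Y closure_of V"
    using U V by (simp_all add: closure_of_subset regular_open_subset_topspace)
  have "Y closure_of (U \<union> V) = topspace Y"
    using sub closure_of_subset_topspace[of Y U] closure_of_subset_topspace[of Y V]
    unfolding closure_of_Un V_eq by blast
  then show "U \<inter> V = {} \<and> Y interior_of (Y closure_of (U \<union> V)) = topspace Y"
    using V_eq sub by auto
qed

lemma regular_open_complement:
  assumes "U \<in> carrier (\<R>\<O> Y)"
  shows "\<sim>\<^bsub>\<R>\<O> Y\<^esub> U = topspace Y - Y closure_of U"
  unfolding complement_def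
proof (rule the_equality)
  let ?V = "topspace Y - Y closure_of U"
  have V: "?V \<in> carrier (\<R>\<O> Y)"
    using assms by (simp add: exterior_regular_open regular_open_imp_open)
  show "?V \<in> carrier (\<R>\<O> Y) \<and> U \<sqinter>\<^bsub>\<R>\<O> Y\<^esub> ?V = \<bottom>\<^bsub>\<R>\<O> Y\<^esub> \<and> U \<squnion>\<^bsub>\<R>\<O> Y\<^esub> ?V = \<top>\<^bsub>\<R>\<O> Y\<^esub>"
    using regular_open_complement_laws[OF assms V] V
    by (simp add: regular_open_meet[OF assms V] regular_open_join[OF assms V])
next
  fix V
  assume "V \<in> carrier (\<R>\<O> Y) \<and> U \<sqinter>\<^bsub>\<R>\<O> Y\<^esub> V = \<bottom>\<^bsub>\<R>\<O> Y\<^esub> \<and> U \<squnion>\<^bsub>\<R>\<O> Y\<^esub> V = \<top>\<^bsub>\<R>\<O> Y\<^esub>"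
  then show "V = topspace Y - Y closure_of U"
    using regular_open_complement_laws[OF assms, of V]
    by (metis assms regular_open_bottom regular_open_join regular_open_meet regular_open_top)
qed

text \<open>
  Distributivity rests on an open set \<open>U\<close> satisfying \<open>U \<inter> cl S \<subseteq> cl (U \<inter> S)\<close>.
\<close>

lemma regular_open_distrib:
  assumes "U \<in> carrier (\<R>\<O> Y)"
  shows "U \<inter> Y interior_of (Y closure_of S) = Y interior_of (Y closure_of (U \<inter> S))"
proof
  have "U \<inter> Y interior_of (Y closure_of S) \<subseteq> Y closure_of (U \<inter> S)"
    using openin_Int_closure_of_subset[OF regular_open_imp_open[OF assms], of S]
      interior_of_subset[of Y "Y closure_of S"] by blast
  then show "U \<inter> Y interior_of (Y closure_of S) \<subseteq> Y interior_of (Y closure_of (U \<inter> S))"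
    by (simp add: assms interior_of_maximal openin_Int regular_open_imp_open)
  show "Y interior_of (Y closure_of (U \<inter> S)) \<subseteq> U \<inter> Y interior_of (Y closure_of S)"
    by (simp add: assms closure_of_mono interior_closure_subset_regular_open interior_of_mono)
qed

text \<open>
  Urysohn's interpolation step with a regular open interpolant: the interior of the closure of an
  ordinary open interpolant has the same closure bound. This gives the density axiom of
  \<open>\<R>\<O> Y\<close> and all approximations of closed and open sets by regular open ones.
\<close>

lemma regular_open_between:
  assumes "normal_space Y" "closedin Y C" "openin Y U" "C \<subseteq> U"
  obtains W where "W \<in> carrier (\<R>\<O> Y)" "C \<subseteq> W" "Y closure_of W \<subseteq> U"
proof -
  obtain V where V: "openin Y V" "C \<subseteq> V" "Y closure_of V \<subseteq> U"
    using assms unfolding normal_space_alt by meson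
  show thesis
  proof
    show "Y interior_of (Y closure_of V) \<in> carrier (\<R>\<O> Y)"
      by (rule interior_closure_regular_open)
    show "C \<subseteq> Y interior_of (Y closure_of V)"
      using V open_subset_interior_closure by blast
    show "Y closure_of (Y interior_of (Y closure_of V)) \<subseteq> U"
      using V by (meson closedin_closure_of closure_of_minimal dual_order.trans interior_of_subset)
  qed
qed

lemma regular_open_base:
  assumes "normal_space Y" "Hausdorff_space Y" "openin Y U" "y \<in> U"
  obtains W where "W \<in> carrier (\<R>\<O> Y)" "y \<in> W" "Y closure_of W \<subseteq> U"
proof -
  have "closedin Y {y}"
    using assms openin_subset[of Y U] by (blast intro: closedin_Hausdorff_singleton)
  then show thesis
    by (rule regular_open_between[OF assms(1) _ assms(3)]) (use assms(4) that in auto)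
qed

lemma open_eq_Union_way_below:
  assumes "normal_space Y" "Hausdorff_space Y" "openin Y U"
  shows "\<Union>{V \<in> carrier (\<R>\<O> Y). Y closure_of V \<subseteq> U} = U"
proof
  show "\<Union>{V \<in> carrier (\<R>\<O> Y). Y closure_of V \<subseteq> U} \<subseteq> U"
    using closure_of_subset[OF regular_open_subset_topspace] by blast
  show "U \<subseteq> \<Union>{V \<in> carrier (\<R>\<O> Y). Y closure_of V \<subseteq> U}"
  proof
    fix y assume "y \<in> U"
    then obtain W where "W \<in> carrier (\<R>\<O> Y)" "y \<in> W" "Y closure_of W \<subseteq> U"
      by (rule regular_open_base[OF assms])
    then show "y \<in> \<Union>{V \<in> carrier (\<R>\<O> Y). Y closure_of V \<subseteq> U}"
      by blast
  qed
qed

lemma complete_boolean_lattice_regular_open: "complete_boolean_lattice (\<R>\<O> Y)"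
proof -
  interpret partial_order "\<R>\<O> Y"
    by (rule regular_open.partial_order)
  show ?thesis
  proof unfold_locales
    fix \<U> assume "\<U> \<subseteq> carrier (\<R>\<O> Y)"
    then show "\<exists>s. is_lub (\<R>\<O> Y) s \<U>" "\<exists>s. is_glb (\<R>\<O> Y) s \<U>"
      using regular_open_sup_ex regular_open_inf_ex by blast+
  next
    fix U V W assume U: "U \<in> carrier (\<R>\<O> Y)" and V: "V \<in> carrier (\<R>\<O> Y)" and W: "W \<in> carrier (\<R>\<O> Y)"
    have "U \<sqinter>\<^bsub>\<R>\<O> Y\<^esub> (V \<squnion>\<^bsub>\<R>\<O> Y\<^esub> W) = U \<inter> Y interior_of (Y closure_of (V \<union> W))"
      by (simp only: U V W regular_open_join regular_open_meet interior_closure_regular_open)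
    also have "\<dots> = Y interior_of (Y closure_of ((U \<inter> V) \<union> (U \<inter> W)))"
      by (simp only: regular_open_distrib[OF U] Int_Un_distrib)
    also have "\<dots> = U \<sqinter>\<^bsub>\<R>\<O> Y\<^esub> V \<squnion>\<^bsub>\<R>\<O> Y\<^esub> (U \<sqinter>\<^bsub>\<R>\<O> Y\<^esub> W)"
      by (simp only: U V W regular_open_join regular_open_meet regular_open_Int)
    finally show "U \<sqinter>\<^bsub>\<R>\<O> Y\<^esub> (V \<squnion>\<^bsub>\<R>\<O> Y\<^esub> W) = U \<sqinter>\<^bsub>\<R>\<O> Y\<^esub> V \<squnion>\<^bsub>\<R>\<O> Y\<^esub> (U \<sqinter>\<^bsub>\<R>\<O> Y\<^esub> W)" .
  next
    fix U assume U: "U \<in> carrier (\<R>\<O> Y)"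
    let ?V = "topspace Y - Y closure_of U"
    have V: "?V \<in> carrier (\<R>\<O> Y)"
      using U by (simp add: exterior_regular_open regular_open_imp_open)
    then show "\<exists>V\<in>carrier (\<R>\<O> Y). U \<sqinter>\<^bsub>\<R>\<O> Y\<^esub> V = \<bottom>\<^bsub>\<R>\<O> Y\<^esub> \<and> U \<squnion>\<^bsub>\<R>\<O> Y\<^esub> V = \<top>\<^bsub>\<R>\<O> Y\<^esub>"
      using regular_open_complement_laws[OF U V]
      by (intro bexI[OF _ V]) (simp add: regular_open_meet[OF U V] regular_open_join[OF U V])
  qed
qed

lemma de_vries_algebra_regular_open:
  assumes "compact_space Y" "Hausdorff_space Y"
  shows "de_vries_algebra (\<R>\<O> Y)"
proof -
  have Y: "normal_space Y"
    using assms by (simp add: compact_Hausdorff_or_regular_imp_normal_space)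
  show ?thesis
  proof (intro de_vries_algebra.intro complete_boolean_lattice_regular_open de_vries_algebra_axioms.intro)
    show "\<top>\<^bsub>\<R>\<O> Y\<^esub> \<prec>\<^bsub>\<R>\<O> Y\<^esub> \<top>\<^bsub>\<R>\<O> Y\<^esub>"
      by simp
  next
    fix U V assume "U \<in> carrier (\<R>\<O> Y)" "U \<prec>\<^bsub>\<R>\<O> Y\<^esub> V"
    then show "U \<sqsubseteq>\<^bsub>\<R>\<O> Y\<^esub> V"
      using closure_of_subset[of U Y] regular_open_subset_topspace[of U Y] by simp
  next
    fix U V W Z
    assume "U \<sqsubseteq>\<^bsub>\<R>\<O> Y\<^esub> V" "V \<prec>\<^bsub>\<R>\<O> Y\<^esub> W" "W \<sqsubseteq>\<^bsub>\<R>\<O> Y\<^esub> Z"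
    then show "U \<prec>\<^bsub>\<R>\<O> Y\<^esub> Z"
      using closure_of_mono[of U V Y] by simp
  next
    fix U V W assume "V \<in> carrier (\<R>\<O> Y)" "W \<in> carrier (\<R>\<O> Y)" "U \<prec>\<^bsub>\<R>\<O> Y\<^esub> V" "U \<prec>\<^bsub>\<R>\<O> Y\<^esub> W"
    then show "U \<prec>\<^bsub>\<R>\<O> Y\<^esub> V \<sqinter>\<^bsub>\<R>\<O> Y\<^esub> W"
      by (simp add: regular_open_meet)
  next
    fix U V assume U: "U \<in> carrier (\<R>\<O> Y)" and V: "V \<in> carrier (\<R>\<O> Y)" and UV: "U \<prec>\<^bsub>\<R>\<O> Y\<^esub> V"
    have "Y closure_of (topspace Y - Y closure_of V) \<subseteq> topspace Y - V"
      using V closure_of_subset[OF regular_open_subset_topspace[OF V]]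
      by (intro closure_of_minimal) (auto simp: closedin_diff regular_open_imp_open)
    then show "\<sim>\<^bsub>\<R>\<O> Y\<^esub> V \<prec>\<^bsub>\<R>\<O> Y\<^esub> \<sim>\<^bsub>\<R>\<O> Y\<^esub> U"
      using UV by (auto simp: regular_open_complement U V)
  next
    fix U V assume U: "U \<in> carrier (\<R>\<O> Y)" and V: "V \<in> carrier (\<R>\<O> Y)" and "U \<prec>\<^bsub>\<R>\<O> Y\<^esub> V"
    then have "Y closure_of U \<subseteq> V"
      by simp
    then obtain W where "W \<in> carrier (\<R>\<O> Y)" "Y closure_of U \<subseteq> W" "Y closure_of W \<subseteq> V"
      by (rule regular_open_between[OF Y closedin_closure_of regular_open_imp_open[OF V]])
    then show "\<exists>W\<in>carrier (\<R>\<O> Y). U \<prec>\<^bsub>\<R>\<O> Y\<^esub> W \<and> W \<prec>\<^bsub>\<R>\<O> Y\<^esub> V"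
      by auto
  next
    fix V assume V: "V \<in> carrier (\<R>\<O> Y)"
    have "\<Squnion>\<^bsub>\<R>\<O> Y\<^esub>{U \<in> carrier (\<R>\<O> Y). U \<prec>\<^bsub>\<R>\<O> Y\<^esub> V}
      = Y interior_of (Y closure_of \<Union>{U \<in> carrier (\<R>\<O> Y). Y closure_of U \<subseteq> V})"
      by (subst regular_open_sup) auto
    also have "\<dots> = V"
      unfolding open_eq_Union_way_below[OF Y assms(2) regular_open_imp_open[OF V]] using V by simp
    finally show "V = \<Squnion>\<^bsub>\<R>\<O> Y\<^esub>{U \<in> carrier (\<R>\<O> Y). U \<prec>\<^bsub>\<R>\<O> Y\<^esub> V}"
      by simp
  qed
qed

section \<open>The de Vries extension of a compactification\<close>

lemma compactification_normal: "compactification X Y e \<Longrightarrow> normal_space Y"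
  by (simp add: compactification_def compact_Hausdorff_or_regular_imp_normal_space)

lemma compactification_maps:
  assumes "compactification X Y e" "x \<in> topspace X"
  shows "e x \<in> topspace Y"
  using assms embedding_map_imp_homeomorphic_space
  unfolding compactification_def
  by (meson embedding_map_def continuous_map_in_subtopology continuous_map_image_subset_topspace
      homeomorphic_imp_continuous_map image_subset_iff)

lemma compactification_continuous: "compactification X Y e \<Longrightarrow> continuous_map X Y e"
  by (meson compactification_def embedding_map_def continuous_map_in_subtopology
      homeomorphic_imp_continuous_map)

lemma compactification_inj: "compactification X Y e \<Longrightarrow> inj_on e (topspace X)"
  by (meson compactification_def embedding_map_def homeomorphic_imp_injective_map)

lemma preimage_map_subset: "preimage_map X e U \<subseteq> topspace X"
  by (auto simp: preimage_map_def)

lemma in_preimage_map_iff: "x \<in> preimage_map X e U \<longleftrightarrow> x \<in> topspace X \<and> e x \<in> U"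
  by (auto simp: preimage_map_def)

lemma closure_of_open_Int_dense:
  assumes "openin Y U" "Y closure_of D = topspace Y"
  shows "Y closure_of (U \<inter> D) = Y closure_of U"
  using closure_of_openin_Int_closure_of[OF assms(1), of D] assms openin_subset[OF assms(1)]
  by (simp add: inf_absorb1)

text \<open>
  Injectivity holds because \<open>e(X)\<close> is dense: an open \<open>U\<close> has the same closure as \<open>U \<inter> e(X)\<close>, so a
  regular open \<open>U\<close> is recovered from its preimage. Every subset of \<open>X\<close> is a join of meets because
  a single point is the meet of the preimages of its regular open neighbourhoods.
\<close>

lemma de_vries_extension_preimage_map:
  assumes e: "compactification X Y e"
  shows "de_vries_extension (\<R>\<O> Y) (\<wp> (topspace X)) (preimage_map X e)"
proof -
  have Y: "compact_space Y" "Hausdorff_space Y" "normal_space Y"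
    using e compactification_normal by (auto simp: compactification_def)
  have dense: "Y closure_of (e ` topspace X) = topspace Y"
    using e by (simp add: compactification_def)
  interpret A: de_vries_algebra "\<R>\<O> Y"
    by (rule de_vries_algebra_regular_open[OF Y(1,2)])
  interpret B: de_vries_algebra "\<wp> (topspace X)"
    by (rule de_vries_algebra_powerset)
  show ?thesis
  proof unfold_locales
    show "preimage_map X e \<in> carrier (\<R>\<O> Y) \<rightarrow> carrier (\<wp> (topspace X))"
      by (simp add: preimage_map_subset)
    show "preimage_map X e \<bottom>\<^bsub>\<R>\<O> Y\<^esub> = \<bottom>\<^bsub>\<wp> (topspace X)\<^esub>"
      by (simp add: preimage_map_def)
  next
    fix U V assume U: "U \<in> carrier (\<R>\<O> Y)" and V: "V \<in> carrier (\<R>\<O> Y)"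
    show "preimage_map X e (U \<sqinter>\<^bsub>\<R>\<O> Y\<^esub> V)
        = preimage_map X e U \<sqinter>\<^bsub>\<wp> (topspace X)\<^esub> preimage_map X e V"
      unfolding regular_open_meet[OF U V] powerset_meet[OF preimage_map_subset preimage_map_subset]
      by (auto simp: preimage_map_def)
  next
    fix U V assume U: "U \<in> carrier (\<R>\<O> Y)" and V: "V \<in> carrier (\<R>\<O> Y)"
      and "U \<prec>\<^bsub>\<R>\<O> Y\<^esub> V"
    then have "Y closure_of U \<subseteq> V"
      by simp
    then have "topspace X - preimage_map X e (topspace Y - Y closure_of U) \<subseteq> preimage_map X e V"
      using compactification_maps[OF e] by (auto simp: preimage_map_def)
    then show "\<sim>\<^bsub>\<wp> (topspace X)\<^esub> (preimage_map X e (\<sim>\<^bsub>\<R>\<O> Y\<^esub> U)) \<prec>\<^bsub>\<wp> (topspace X)\<^esub> preimage_map X e V"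
      unfolding regular_open_complement[OF U] powerset_complement[OF preimage_map_subset] by simp
  next
    fix V assume V: "V \<in> carrier (\<R>\<O> Y)"
    have "\<Squnion>\<^bsub>\<wp> (topspace X)\<^esub>(preimage_map X e ` {U \<in> carrier (\<R>\<O> Y). U \<prec>\<^bsub>\<R>\<O> Y\<^esub> V})
        = \<Union>(preimage_map X e ` {U \<in> carrier (\<R>\<O> Y). Y closure_of U \<subseteq> V})"
      by (subst powerset_sup) (use preimage_map_subset[of X e] in auto)
    also have "\<dots> = preimage_map X e (\<Union>{U \<in> carrier (\<R>\<O> Y). Y closure_of U \<subseteq> V})"
      unfolding preimage_map_def by blast
    also have "\<dots> = preimage_map X e V"
      by (simp only: open_eq_Union_way_below[OF Y(3,2) regular_open_imp_open[OF V]])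
    finally show "preimage_map X e V =
      \<Squnion>\<^bsub>\<wp> (topspace X)\<^esub>(preimage_map X e ` {U \<in> carrier (\<R>\<O> Y). U \<prec>\<^bsub>\<R>\<O> Y\<^esub> V})"
      by (rule sym)
  next
    show "inj_on (preimage_map X e) (carrier (\<R>\<O> Y))"
    proof (rule inj_onI)
      have recover: "Y interior_of (Y closure_of (e ` preimage_map X e U)) = U"
        if U: "U \<in> carrier (\<R>\<O> Y)" for U
      proof -
        have "e ` preimage_map X e U = U \<inter> e ` topspace X"
          unfolding preimage_map_def by blast
        then show ?thesis
          using closure_of_open_Int_dense[OF regular_open_imp_open[OF U] dense] U by simp
      qed
      fix U V assume "U \<in> carrier (\<R>\<O> Y)" "V \<in> carrier (\<R>\<O> Y)"
        and "preimage_map X e U = preimage_map X e V"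
      then show "U = V"
        using recover by metis
    qed
  next
    show "atomic (\<wp> (topspace X))"
      unfolding atomic_def
    proof (intro ballI impI)
      fix S assume "S \<in> carrier (\<wp> (topspace X))" "S \<noteq> \<bottom>\<^bsub>\<wp> (topspace X)\<^esub>"
      then obtain x where "x \<in> S" "S \<subseteq> topspace X"
        by auto
      then show "\<exists>a. atom (\<wp> (topspace X)) a \<and> a \<sqsubseteq>\<^bsub>\<wp> (topspace X)\<^esub> S"
        by (intro exI[of _ "{x}"]) (auto simp: atom_def)
    qed
    show "extremally_disconnected (\<wp> (topspace X))"
      by (simp add: extremally_disconnected_def)
  next
    fix S assume "S \<in> carrier (\<wp> (topspace X))"
    then have S: "S \<subseteq> topspace X"
      by simp
    let ?N = "\<lambda>x. {U \<in> carrier (\<R>\<O> Y). e x \<in> U}"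
    have meet_nbhds: "\<Sqinter>\<^bsub>\<wp> (topspace X)\<^esub>(preimage_map X e ` ?N x) = {x}" if x: "x \<in> topspace X" for x
    proof -
      have "y = x" if y: "y \<in> topspace X" "\<And>U. U \<in> ?N x \<Longrightarrow> e y \<in> U" for y
      proof (rule ccontr)
        assume "y \<noteq> x"
        then have "e x \<in> topspace Y - {e y}"
          using compactification_inj[OF e] compactification_maps[OF e] x y(1)
          by (auto dest: inj_onD)
        moreover have "openin Y (topspace Y - {e y})"
          using Y(2) compactification_maps[OF e y(1)]
          by (simp add: closedin_Hausdorff_singleton openin_diff)
        ultimately obtain W where W: "W \<in> carrier (\<R>\<O> Y)" "e x \<in> W" "Y closure_of W \<subseteq> topspace Y - {e y}"
          using regular_open_base[OF Y(3,2)] by metis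
        then show False
          using y(2)[of W] closure_of_subset[OF regular_open_subset_topspace[OF W(1)]] by blast
      qed
      then have "topspace X \<inter> \<Inter>(preimage_map X e ` ?N x) = {x}"
        using x by (auto simp: in_preimage_map_iff)
      moreover have "preimage_map X e ` ?N x \<subseteq> Pow (topspace X)"
        using preimage_map_subset[of X e] by blast
      ultimately show ?thesis
        by (simp only: powerset_inf)
    qed
    have "(\<lambda>M. \<Sqinter>\<^bsub>\<wp> (topspace X)\<^esub>M) ` (\<lambda>x. preimage_map X e ` ?N x) ` S = (\<lambda>x. {x}) ` S"
      unfolding image_image using S meet_nbhds by (intro image_cong) auto
    moreover have "\<Squnion>\<^bsub>\<wp> (topspace X)\<^esub>((\<lambda>x. {x}) ` S) = S"
      by (subst powerset_sup) (use S in auto)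
    ultimately show "\<exists>\<M>. \<M> \<subseteq> Pow (preimage_map X e ` carrier (\<R>\<O> Y)) \<and>
        S = \<Squnion>\<^bsub>\<wp> (topspace X)\<^esub>((\<lambda>M. \<Sqinter>\<^bsub>\<wp> (topspace X)\<^esub>M) ` \<M>)"
      by (intro exI[of _ "(\<lambda>x. preimage_map X e ` ?N x) ` S"]) auto
  qed
qed

section \<open>Normality of the extension as separation of closed sets\<close>

text \<open>
  Taimanov's condition for extending a continuous map, imposed on all pairs of disjoint closed sets
  and not just on the preimages under one map. For a compactification of \<open>X\<close> it implies that \<open>X\<close> is normal,
  which extendability of all maps into compact Hausdorff spaces does not.
\<close>

definition separates_closed_sets :: "'a topology \<Rightarrow> 'b topology \<Rightarrow> ('a \<Rightarrow> 'b) \<Rightarrow> bool"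
  where "separates_closed_sets X Y e \<longleftrightarrow> (\<forall>D E. closedin X D \<and> closedin X E \<and> disjnt D E \<longrightarrow>
    disjnt (Y closure_of (e ` D)) (Y closure_of (e ` E)))"

text \<open>
  Taking the closure of the image in \<open>Y\<close> adds no points of \<open>X\<close>, so every closed subset of \<open>X\<close> is the
  trace of a closed subset of \<open>Y\<close>.
\<close>

lemma embedding_preimage_closure_image:
  assumes "embedding_map X Y e" "closedin X D"
  shows "preimage_map X e (Y closure_of (e ` D)) = D"
proof -
  have hom: "homeomorphic_map X (subtopology Y (e ` topspace X)) e"
    using assms by (simp add: embedding_map_def)
  have "closedin (subtopology Y (e ` topspace X)) (e ` D)"
    using assms(2) closedin_subset[OF assms(2)] homeomorphic_map_closedness[OF hom] by blast
  then have "(subtopology Y (e ` topspace X)) closure_of (e ` D) = e ` D"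
    by (simp add: closure_of_closedin)
  moreover have "e ` topspace X \<inter> e ` D = e ` D"
    using closedin_subset[OF assms(2)] by blast
  ultimately have "e ` topspace X \<inter> Y closure_of (e ` D) = e ` D"
    by (simp add: closure_of_subtopology)
  then show ?thesis
    using homeomorphic_imp_injective_map[OF hom] closedin_subset[OF assms(2)]
    unfolding preimage_map_def by (auto dest: inj_onD)
qed

lemma round_filter_nbhds:
  assumes "normal_space Y" "closedin Y C"
  shows "round_filter (\<R>\<O> Y) {V \<in> carrier (\<R>\<O> Y). C \<subseteq> V}"
  unfolding round_filter_def
proof (intro conjI ballI impI)
  show "{V \<in> carrier (\<R>\<O> Y). C \<subseteq> V} \<noteq> {}"
    using topspace_regular_open closedin_subset[OF assms(2)] by blast
next
  fix U V assume "U \<in> {V \<in> carrier (\<R>\<O> Y). C \<subseteq> V}" "V \<in> {V \<in> carrier (\<R>\<O> Y). C \<subseteq> V}"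
  then show "U \<sqinter>\<^bsub>\<R>\<O> Y\<^esub> V \<in> {V \<in> carrier (\<R>\<O> Y). C \<subseteq> V}"
    by (simp add: regular_open_meet regular_open_Int)
next
  fix V assume "V \<in> {V \<in> carrier (\<R>\<O> Y). C \<subseteq> V}"
  then have "openin Y V" "C \<subseteq> V"
    by (auto simp: regular_open_imp_open)
  then obtain W where "W \<in> carrier (\<R>\<O> Y)" "C \<subseteq> W" "Y closure_of W \<subseteq> V"
    by (rule regular_open_between[OF assms])
  then show "\<exists>W\<in>{V \<in> carrier (\<R>\<O> Y). C \<subseteq> V}. W \<prec>\<^bsub>\<R>\<O> Y\<^esub> V"
    by auto
qed auto

text \<open>
  Closure under joins is the delicate part, since a join in \<open>\<R>\<O> Y\<close> is larger than the union; it
  is however contained in \<open>cl (V \<union> W) = cl V \<union> cl W\<close>, which lies in \<open>U\<close>.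
\<close>

lemma round_ideal_way_below:
  assumes "normal_space Y" "openin Y U"
  shows "round_ideal (\<R>\<O> Y) {V \<in> carrier (\<R>\<O> Y). Y closure_of V \<subseteq> U}"
  unfolding round_ideal_def
proof (intro conjI ballI impI)
  show "{V \<in> carrier (\<R>\<O> Y). Y closure_of V \<subseteq> U} \<noteq> {}"
    using empty_regular_open[of Y] by (metis (no_types, lifting) closure_of_empty empty_iff empty_subsetI mem_Collect_eq)
next
  fix V W assume VW: "V \<in> {V \<in> carrier (\<R>\<O> Y). Y closure_of V \<subseteq> U}" "W \<in> {V \<in> carrier (\<R>\<O> Y). Y closure_of V \<subseteq> U}"
  have "Y closure_of (Y interior_of (Y closure_of (V \<union> W))) \<subseteq> Y closure_of (V \<union> W)"
    by (intro closure_of_minimal interior_of_subset closedin_closure_of)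
  also have "\<dots> \<subseteq> U"
    using VW by simp
  finally show "V \<squnion>\<^bsub>\<R>\<O> Y\<^esub> W \<in> {V \<in> carrier (\<R>\<O> Y). Y closure_of V \<subseteq> U}"
    using VW by (simp add: regular_open_join interior_closed_regular_open closedin_Un)
next
  fix V W assume "V \<in> {V \<in> carrier (\<R>\<O> Y). Y closure_of V \<subseteq> U}" "W \<in> carrier (\<R>\<O> Y)" "W \<sqsubseteq>\<^bsub>\<R>\<O> Y\<^esub> V"
  then show "W \<in> {V \<in> carrier (\<R>\<O> Y). Y closure_of V \<subseteq> U}"
    using closure_of_mono[of W V Y] by auto
next
  fix V assume "V \<in> {V \<in> carrier (\<R>\<O> Y). Y closure_of V \<subseteq> U}"
  then have "Y closure_of V \<subseteq> U"
    by blast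
  then obtain W where W: "W \<in> carrier (\<R>\<O> Y)" "Y closure_of V \<subseteq> W" "Y closure_of W \<subseteq> U"
    by (rule regular_open_between[OF assms(1) closedin_closure_of assms(2)])
  then show "\<exists>W\<in>{V \<in> carrier (\<R>\<O> Y). Y closure_of V \<subseteq> U}. V \<prec>\<^bsub>\<R>\<O> Y\<^esub> W"
    by auto
qed auto

lemma closed_eq_Inter_nbhds:
  assumes "normal_space Y" "Hausdorff_space Y" "closedin Y C"
  shows "\<Inter>{V \<in> carrier (\<R>\<O> Y). C \<subseteq> V} = C"
proof
  show "\<Inter>{V \<in> carrier (\<R>\<O> Y). C \<subseteq> V} \<subseteq> C"
  proof
    fix y assume y: "y \<in> \<Inter>{V \<in> carrier (\<R>\<O> Y). C \<subseteq> V}"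
    then have "y \<in> topspace Y"
      using topspace_regular_open closedin_subset[OF assms(3)] by blast
    show "y \<in> C"
    proof (rule ccontr)
      assume "y \<notin> C"
      have "openin Y (topspace Y - {y})"
        using assms(2) \<open>y \<in> topspace Y\<close> by (simp add: closedin_Hausdorff_singleton openin_diff)
      moreover have "C \<subseteq> topspace Y - {y}"
        using \<open>y \<notin> C\<close> closedin_subset[OF assms(3)] by blast
      ultimately obtain W where W: "W \<in> carrier (\<R>\<O> Y)" "C \<subseteq> W" "Y closure_of W \<subseteq> topspace Y - {y}"
        by (rule regular_open_between[OF assms(1,3)])
      then show False
        using y closure_of_subset[OF regular_open_subset_topspace[OF W(1)]] by blast
    qed
  qed
qed blast

text \<open>
  Roundness lets the members be replaced by their closures without changing the intersection.
\<close>

lemma closedin_Inter_round_filter: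
  assumes "round_filter (\<R>\<O> Y) F"
  shows "closedin Y (\<Inter>F)"
proof -
  have F: "F \<subseteq> carrier (\<R>\<O> Y)" "F \<noteq> {}" "\<And>V. V \<in> F \<Longrightarrow> \<exists>W\<in>F. Y closure_of W \<subseteq> V"
    using assms by (auto simp: round_filter_def)
  have "\<Inter>F = \<Inter>((\<lambda>V. Y closure_of V) ` F)"
  proof
    show "\<Inter>F \<subseteq> \<Inter>((\<lambda>V. Y closure_of V) ` F)"
      using F(1) closure_of_subset[OF regular_open_subset_topspace] by blast
    show "\<Inter>((\<lambda>V. Y closure_of V) ` F) \<subseteq> \<Inter>F"
      using F(3) by blast
  qed
  moreover have "closedin Y (\<Inter>((\<lambda>V. Y closure_of V) ` F))"
    using F(2) by (intro closedin_Inter) auto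
  ultimately show ?thesis
    by (simp only:)
qed

lemma openin_Union_round_ideal: "round_ideal (\<R>\<O> Y) I \<Longrightarrow> openin Y (\<Union>I)"
  unfolding round_ideal_def by (intro openin_Union) (blast intro: regular_open_imp_open)

lemma preimage_inf_filter:
  assumes "round_filter (\<R>\<O> Y) F"
  shows "\<Sqinter>\<^bsub>\<wp> (topspace X)\<^esub>(preimage_map X e ` F) = preimage_map X e (\<Inter>F)"
proof -
  have "F \<noteq> {}"
    using assms by (simp add: round_filter_def)
  then have "topspace X \<inter> \<Inter>(preimage_map X e ` F) = preimage_map X e (\<Inter>F)"
    unfolding preimage_map_def by blast
  moreover have "preimage_map X e ` F \<subseteq> Pow (topspace X)"
    using preimage_map_subset[of X e] by blast
  ultimately show ?thesis
    by (simp only: powerset_inf)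
qed

lemma preimage_sup: "\<Squnion>\<^bsub>\<wp> (topspace X)\<^esub>(preimage_map X e ` I) = preimage_map X e (\<Union>I)"
proof -
  have "\<Union>(preimage_map X e ` I) = preimage_map X e (\<Union>I)"
    unfolding preimage_map_def by blast
  moreover have "preimage_map X e ` I \<subseteq> Pow (topspace X)"
    using preimage_map_subset[of X e] by blast
  ultimately show ?thesis
    by (simp only: powerset_sup)
qed

text \<open>
  Normality is applied to the round filter of neighbourhoods of \<open>cl e(D)\<close> and the round ideal below
  the complement of \<open>cl e(E)\<close>. Its hypothesis only involves the traces \<open>D\<close> and \<open>X - E\<close>, but the resulting
  \<open>a \<prec> b\<close> is a statement in \<open>Y\<close>: \<open>cl e(D) \<subseteq> cl a \<subseteq> b\<close>, while the open set \<open>b\<close> misses \<open>e(E)\<close> and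
  therefore its closure.
\<close>

lemma normal_extension_imp_separates:
  assumes e: "compactification X Y e"
    and normal: "normal_de_vries_extension (\<R>\<O> Y) (\<wp> (topspace X)) (preimage_map X e)"
  shows "separates_closed_sets X Y e"
  unfolding separates_closed_sets_def
proof (intro allI impI, elim conjE)
  fix D E assume D: "closedin X D" and E: "closedin X E" and disj: "disjnt D E"
  have Y: "normal_space Y" "Hausdorff_space Y" and emb: "embedding_map X Y e"
    using e compactification_normal by (auto simp: compactification_def)
  define C where "C = Y closure_of (e ` D)"
  define U where "U = topspace Y - Y closure_of (e ` E)"
  have C: "closedin Y C" and U: "openin Y U"
    by (simp_all add: C_def U_def openin_diff)
  let ?F = "{V \<in> carrier (\<R>\<O> Y). C \<subseteq> V}" and ?I = "{V \<in> carrier (\<R>\<O> Y). Y closure_of V \<subseteq> U}"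
  have preC: "preimage_map X e C = D"
    unfolding C_def by (rule embedding_preimage_closure_image[OF emb D])
  have preU: "preimage_map X e U = topspace X - E"
    using embedding_preimage_closure_image[OF emb E] compactification_maps[OF e]
    unfolding U_def preimage_map_def by blast
  have inf_eq: "\<Sqinter>\<^bsub>\<wp> (topspace X)\<^esub>(preimage_map X e ` ?F) = D"
    unfolding preimage_inf_filter[OF round_filter_nbhds[OF Y(1) C]] closed_eq_Inter_nbhds[OF Y C] preC ..
  have sup_eq: "\<Squnion>\<^bsub>\<wp> (topspace X)\<^esub>(preimage_map X e ` ?I) = topspace X - E"
    unfolding preimage_sup open_eq_Union_way_below[OF Y U] preU ..
  have "D \<subseteq> topspace X - E"
    using closedin_subset[OF D] disj by (auto simp: disjnt_iff)
  then obtain a b where ab: "a \<in> carrier (\<R>\<O> Y)" "b \<in> carrier (\<R>\<O> Y)" "Y closure_of a \<subseteq> b"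
      "D \<subseteq> preimage_map X e a" "preimage_map X e b \<subseteq> topspace X - E"
    using normal_de_vries_extension.normal[OF normal round_filter_nbhds[OF Y(1) C] round_ideal_way_below[OF Y(1) U]]
    unfolding inf_eq sup_eq by auto
  have "e ` D \<subseteq> a"
    using ab(4) by (auto simp: in_preimage_map_iff)
  then have "Y closure_of (e ` D) \<subseteq> b"
    using ab(3) closure_of_mono by blast
  moreover have "b \<inter> e ` E = {}"
    using ab(5) closedin_subset[OF E] unfolding preimage_map_def by blast
  then have "b \<inter> Y closure_of (e ` E) = {}"
    by (simp add: openin_Int_closure_of_eq_empty regular_open_imp_open[OF ab(2)])
  ultimately show "disjnt (Y closure_of (e ` D)) (Y closure_of (e ` E))"
    unfolding disjnt_def by blast
qed

text \<open>
  The traces of \<open>\<Inter>F\<close> and of the complement of \<open>\<Union>I\<close> are disjoint closed sets in \<open>X\<close>. Their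
  images have disjoint closures, and interpolating twice between these in the normal
  space \<open>Y\<close> gives \<open>a \<prec> b\<close>.
\<close>

lemma separates_imp_normal_extension:
  assumes e: "compactification X Y e" and sep: "separates_closed_sets X Y e"
  shows "normal_de_vries_extension (\<R>\<O> Y) (\<wp> (topspace X)) (preimage_map X e)"
proof (intro normal_de_vries_extension.intro de_vries_extension_preimage_map[OF e]
    normal_de_vries_extension_axioms.intro)
  fix F I assume F: "round_filter (\<R>\<O> Y) F" and I: "round_ideal (\<R>\<O> Y) I"
    and le: "\<Sqinter>\<^bsub>\<wp> (topspace X)\<^esub>(preimage_map X e ` F) \<sqsubseteq>\<^bsub>\<wp> (topspace X)\<^esub>
      \<Squnion>\<^bsub>\<wp> (topspace X)\<^esub>(preimage_map X e ` I)"
  have Y: "normal_space Y"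
    using e by (rule compactification_normal)
  define D where "D = preimage_map X e (\<Inter>F)"
  define E where "E = topspace X - preimage_map X e (\<Union>I)"
  have inf_eq: "\<Sqinter>\<^bsub>\<wp> (topspace X)\<^esub>(preimage_map X e ` F) = D"
    unfolding D_def by (rule preimage_inf_filter[OF F])
  have sup_eq: "\<Squnion>\<^bsub>\<wp> (topspace X)\<^esub>(preimage_map X e ` I) = topspace X - E"
    unfolding E_def preimage_sup using preimage_map_subset[of X e "\<Union>I"] by (simp add: double_diff)
  have cont: "continuous_map X Y e"
    using e by (rule compactification_continuous)
  have D: "closedin X D"
    unfolding D_def preimage_map_def
    by (rule closedin_continuous_map_preimage[OF cont closedin_Inter_round_filter[OF F]])
  have E: "closedin X E"
    unfolding E_def preimage_map_def
    by (intro closedin_diff closedin_topspace openin_continuous_map_preimage[OF cont openin_Union_round_ideal[OF I]])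
  have "disjnt D E"
    using le unfolding inf_eq sup_eq by (auto simp: disjnt_iff)
  then have disj: "disjnt (Y closure_of (e ` D)) (Y closure_of (e ` E))"
    using sep D E unfolding separates_closed_sets_def by blast
  let ?U = "topspace Y - Y closure_of (e ` E)"
  have "Y closure_of (e ` D) \<subseteq> ?U"
    using disj closure_of_subset_topspace[of Y "e ` D"] by (auto simp: disjnt_iff)
  then obtain b where b: "b \<in> carrier (\<R>\<O> Y)" "Y closure_of (e ` D) \<subseteq> b" "Y closure_of b \<subseteq> ?U"
    by (rule regular_open_between[OF Y closedin_closure_of openin_diff[OF openin_topspace closedin_closure_of]])
  from b(2) obtain a where a: "a \<in> carrier (\<R>\<O> Y)" "Y closure_of (e ` D) \<subseteq> a" "Y closure_of a \<subseteq> b"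
    by (rule regular_open_between[OF Y closedin_closure_of regular_open_imp_open[OF b(1)]])
  have "e ` D \<subseteq> topspace Y" "e ` E \<subseteq> topspace Y"
    using closedin_subset[OF D] closedin_subset[OF E] compactification_maps[OF e] by blast+
  then have cl: "e ` D \<subseteq> Y closure_of (e ` D)" "e ` E \<subseteq> Y closure_of (e ` E)"
    by (simp_all add: closure_of_subset)
  have "D \<subseteq> preimage_map X e a"
    using cl(1) a(2) closedin_subset[OF D] unfolding preimage_map_def by blast
  moreover have "preimage_map X e b \<subseteq> topspace X - E"
    using cl(2) b(3) closure_of_subset[OF regular_open_subset_topspace[OF b(1)]]
    unfolding preimage_map_def by blast
  ultimately show "\<exists>a\<in>carrier (\<R>\<O> Y). \<exists>b\<in>carrier (\<R>\<O> Y). a \<prec>\<^bsub>\<R>\<O> Y\<^esub> b \<and>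
      \<Sqinter>\<^bsub>\<wp> (topspace X)\<^esub>(preimage_map X e ` F) \<sqsubseteq>\<^bsub>\<wp> (topspace X)\<^esub> preimage_map X e a \<and>
      preimage_map X e b \<sqsubseteq>\<^bsub>\<wp> (topspace X)\<^esub> \<Squnion>\<^bsub>\<wp> (topspace X)\<^esub>(preimage_map X e ` I)"
    unfolding inf_eq sup_eq using a(1,3) b(1) by auto
qed

lemma normal_extension_iff_separates:
  assumes "compactification X Y e"
  shows "normal_de_vries_extension (\<R>\<O> Y) (\<wp> (topspace X)) (preimage_map X e) \<longleftrightarrow>
    separates_closed_sets X Y e"
  using assms normal_extension_imp_separates separates_imp_normal_extension by blast

lemma separates_imp_normal_space:
  assumes "compactification X Y e" "separates_closed_sets X Y e"
  shows "normal_space X"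
  unfolding normal_space_def
proof (intro allI impI, elim conjE)
  fix D E assume D: "closedin X D" and E: "closedin X E" and "disjnt D E"
  then have "disjnt (Y closure_of (e ` D)) (Y closure_of (e ` E))"
    using assms(2) by (simp add: separates_closed_sets_def)
  then obtain U V where UV: "openin Y U" "openin Y V" "Y closure_of (e ` D) \<subseteq> U" "Y closure_of (e ` E) \<subseteq> V" "disjnt U V"
    using compactification_normal[OF assms(1)] unfolding normal_space_def
    by (meson closedin_closure_of)
  have cont: "continuous_map X Y e"
    using assms(1) by (rule compactification_continuous)
  have "e ` D \<subseteq> topspace Y" "e ` E \<subseteq> topspace Y"
    using closedin_subset[OF D] closedin_subset[OF E] compactification_maps[OF assms(1)] by blast+
  then have "e ` D \<subseteq> U" "e ` E \<subseteq> V"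
    using UV(3,4) closure_of_subset[of "e ` D" Y] closure_of_subset[of "e ` E" Y] by blast+
  then have "D \<subseteq> {x \<in> topspace X. e x \<in> U}" "E \<subseteq> {x \<in> topspace X. e x \<in> V}"
    using closedin_subset[OF D] closedin_subset[OF E] by blast+
  moreover have "disjnt {x \<in> topspace X. e x \<in> U} {x \<in> topspace X. e x \<in> V}"
    using UV(5) by (auto simp: disjnt_iff)
  moreover have "openin X {x \<in> topspace X. e x \<in> U}" "openin X {x \<in> topspace X. e x \<in> V}"
    using UV(1,2) by (simp_all add: openin_continuous_map_preimage[OF cont])
  ultimately show "\<exists>U V. openin X U \<and> openin X V \<and> D \<subseteq> U \<and> E \<subseteq> V \<and> disjnt U V"
    by blast
qed

section \<open>Extending maps to a compactification\<close>

text \<open>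
  A Taimanov-type extension theorem. Let \<open>G\<close> be the closure of \<open>{(e x, f x)}\<close> in \<open>Y \<times> K\<close>. The
  projection of the compact set \<open>G\<close> to \<open>Y\<close> is onto because its image is closed and contains the dense set
  \<open>e(X)\<close>. It is injective because two points \<open>(y, z)\<close> and \<open>(y, z')\<close> of \<open>G\<close> with \<open>z \<noteq> z'\<close> would put \<open>y\<close> into the
  closures of the images of two disjoint closed sets, the preimages under \<open>f\<close> of disjoint closed
  neighbourhoods of \<open>z\<close> and \<open>z'\<close>. A continuous bijection from a compact space to a Hausdorff space is a
  homeomorphism, so \<open>G\<close> is the graph of a continuous map.
\<close>

lemma separates_imp_extends:
  assumes Y: "compact_space Y" "Hausdorff_space Y"
    and dense: "Y closure_of (e ` topspace X) = topspace Y" "e ` topspace X \<subseteq> topspace Y"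
    and sep: "separates_closed_sets X Y e"
    and K: "compact_space K" "Hausdorff_space K" and f: "continuous_map X K f"
  obtains g where "continuous_map Y K g" "\<And>x. x \<in> topspace X \<Longrightarrow> g (e x) = f x"
proof -
  define G where "G = prod_topology Y K closure_of ((\<lambda>x. (e x, f x)) ` topspace X)"
  define P where "P = subtopology (prod_topology Y K) G"
  have K_normal: "normal_space K"
    using K by (simp add: compact_Hausdorff_or_regular_imp_normal_space)
  have fK: "f x \<in> topspace K" if "x \<in> topspace X" for x
    using f that by (auto simp: continuous_map_def)
  have G_sub: "G \<subseteq> topspace Y \<times> topspace K"
    using closure_of_subset_topspace[of "prod_topology Y K"] by (simp add: G_def)
  have top_P: "topspace P = G"
    using G_sub by (auto simp: P_def)
  have graph: "(e x, f x) \<in> G" if "x \<in> topspace X" for x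
  proof -
    have "(\<lambda>x. (e x, f x)) ` topspace X \<subseteq> topspace (prod_topology Y K)"
      using dense(2) fK by auto
    then show ?thesis
      unfolding G_def using closure_of_subset that by blast
  qed
  have "compact_space (prod_topology Y K)"
    using Y K by (simp add: compact_space_prod_topology)
  then have compact_P: "compact_space P"
    unfolding P_def by (intro compact_space_subtopology closedin_compact_space) (simp_all add: G_def)
  have fst: "continuous_map P Y fst" and snd: "continuous_map P K snd"
    unfolding P_def by (auto intro: continuous_map_from_subtopology continuous_map_fst continuous_map_snd)
  have "fst ` topspace P = topspace Y"
  proof
    show "fst ` topspace P \<subseteq> topspace Y"
      using G_sub by (auto simp: top_P)
    have "closedin Y (fst ` topspace P)"
      using continuous_imp_closed_map[OF fst compact_P Y(2)] by (simp add: closed_map_def)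
    moreover have "e ` topspace X \<subseteq> fst ` topspace P"
      using graph unfolding top_P by force
    ultimately show "topspace Y \<subseteq> fst ` topspace P"
      using closure_of_minimal dense(1) by metis
  qed
  moreover have "inj_on fst (topspace P)"
  proof -
    \<comment> \<open>Every neighbourhood of \<open>(y, z)\<close> contains some \<open>(e x, f x)\<close>; products with \<open>W\<close> give \<open>f x \<in> W\<close>.\<close>
    have in_closure: "y \<in> Y closure_of (e ` {x \<in> topspace X. f x \<in> K closure_of W})"
      if yz: "(y, z) \<in> G" and W: "openin K W" "z \<in> W" for y z W
    proof (rule in_closure_of[THEN iffD2], intro conjI allI impI)
      show "y \<in> topspace Y"
        using yz G_sub by blast
      fix T assume "y \<in> T \<and> openin Y T"
      then have "openin (prod_topology Y K) (T \<times> W)" "(y, z) \<in> T \<times> W"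
        using W by (auto simp: openin_prod_Times_iff)
      then obtain p where "p \<in> (\<lambda>x. (e x, f x)) ` topspace X" "p \<in> T \<times> W"
        using yz unfolding G_def in_closure_of by metis
      then obtain x where "x \<in> topspace X" "e x \<in> T" "f x \<in> W"
        by auto
      moreover have "W \<subseteq> K closure_of W"
        using W(1) by (simp add: closure_of_subset openin_subset)
      ultimately show "\<exists>t. t \<in> e ` {x \<in> topspace X. f x \<in> K closure_of W} \<and> t \<in> T"
        by blast
    qed
    have "z = z'" if yz: "(y, z) \<in> G" "(y, z') \<in> G" for y z z'
    proof (rule ccontr)
      assume "z \<noteq> z'"
      have z: "z \<in> topspace K" "z' \<in> topspace K"
        using yz G_sub by blast+
      have "openin K (topspace K - {z'})"
        using K(2) z(2) by (simp add: closedin_Hausdorff_singleton openin_diff)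
      then obtain W where W: "W \<in> carrier (\<R>\<O> K)" "z \<in> W" "K closure_of W \<subseteq> topspace K - {z'}"
        by (rule regular_open_base[OF K_normal K(2), of _ z]) (use z \<open>z \<noteq> z'\<close> in blast)
      have "openin K (topspace K - K closure_of W)"
        by (simp add: openin_diff)
      then obtain W' where W': "W' \<in> carrier (\<R>\<O> K)" "z' \<in> W'" "K closure_of W' \<subseteq> topspace K - K closure_of W"
        by (rule regular_open_base[OF K_normal K(2), of _ z']) (use z W in blast)
      let ?D = "{x \<in> topspace X. f x \<in> K closure_of W}" and ?D' = "{x \<in> topspace X. f x \<in> K closure_of W'}"
      have "closedin X ?D" "closedin X ?D'"
        by (simp_all add: closedin_continuous_map_preimage[OF f])
      moreover have "disjnt ?D ?D'"
        using W'(3) by (auto simp: disjnt_iff)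
      ultimately have "disjnt (Y closure_of (e ` ?D)) (Y closure_of (e ` ?D'))"
        using sep unfolding separates_closed_sets_def by blast
      moreover have "y \<in> Y closure_of (e ` ?D)" "y \<in> Y closure_of (e ` ?D')"
        using in_closure[OF yz(1) regular_open_imp_open[OF W(1)] W(2)]
          in_closure[OF yz(2) regular_open_imp_open[OF W'(1)] W'(2)] by simp_all
      ultimately show False
        by (auto simp: disjnt_iff)
    qed
    then show ?thesis
      unfolding top_P by (auto simp: inj_on_def)
  qed
  ultimately have "homeomorphic_map P Y fst"
    using continuous_imp_homeomorphic_map[OF fst compact_P Y(2)] by blast
  then obtain h where h: "homeomorphic_maps P Y fst h"
    by (auto simp: homeomorphic_map_maps)
  show thesis
  proof
    show "continuous_map Y K (snd \<circ> h)"
      using h snd by (auto simp: homeomorphic_maps_def intro: continuous_map_compose)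
    fix x assume "x \<in> topspace X"
    then have "h (fst (e x, f x)) = (e x, f x)"
      using h graph unfolding homeomorphic_maps_def top_P by blast
    then show "(snd \<circ> h) (e x) = f x"
      by simp
  qed
qed

lemma separating_compactifications_isomorphic:
  assumes e: "compactification X Y e" "separates_closed_sets X Y e"
    and e': "compactification X Z e'" "separates_closed_sets X Z e'"
  shows "Comp_isomorphic X Y e X Z e'"
proof -
  have Y: "compact_space Y" "Hausdorff_space Y" "Y closure_of (e ` topspace X) = topspace Y"
    and Z: "compact_space Z" "Hausdorff_space Z" "Z closure_of (e' ` topspace X) = topspace Z"
    using e(1) e'(1) by (auto simp: compactification_def)
  have im: "e ` topspace X \<subseteq> topspace Y" "e' ` topspace X \<subseteq> topspace Z"
    using compactification_maps[OF e(1)] compactification_maps[OF e'(1)] by blast+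
  obtain g where g: "continuous_map Y Z g" "\<And>x. x \<in> topspace X \<Longrightarrow> g (e x) = e' x"
    using separates_imp_extends[OF Y im(1) e(2) Z(1,2) compactification_continuous[OF e'(1)]] by blast
  obtain h where h: "continuous_map Z Y h" "\<And>x. x \<in> topspace X \<Longrightarrow> h (e' x) = e x"
    using separates_imp_extends[OF Z im(2) e'(2) Y(1,2) compactification_continuous[OF e(1)]] by blast
  have "(h \<circ> g) y = id y" if "y \<in> topspace Y" for y
  proof (rule forall_in_closure_of_eq[of y Y "e ` topspace X"])
    show "continuous_map Y Y (h \<circ> g)"
      using g(1) h(1) by (rule continuous_map_compose)
  qed (use that Y g h in auto)
  moreover have "(g \<circ> h) z = id z" if "z \<in> topspace Z" for z
  proof (rule forall_in_closure_of_eq[of z Z "e' ` topspace X"])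
    show "continuous_map Z Z (g \<circ> h)"
      using h(1) g(1) by (rule continuous_map_compose)
  qed (use that Z g h in auto)
  ultimately have "homeomorphic_map Y Z g"
    using g(1) h(1) by (auto simp: homeomorphic_map_maps homeomorphic_maps_def)
  moreover have "homeomorphic_map X X id"
    by (simp add: homeomorphic_map_id)
  ultimately show ?thesis
    unfolding Comp_isomorphic_def Comp_morphism_def using g by (intro exI[of _ id] exI[of _ g]) auto
qed

text \<open>
  An isomorphism in the category of compactifications may move the points of \<open>X\<close>; the
  homeomorphism \<open>f\<close> carries disjoint closed sets to disjoint closed sets, and \<open>g\<close> carries
  closures of images to closures of images.
\<close>

lemma Comp_isomorphic_separates:
  assumes e: "compactification X Y e" and iso: "Comp_isomorphic X Y e X' Y' e'"
    and sep: "separates_closed_sets X' Y' e'"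
  shows "separates_closed_sets X Y e"
  unfolding separates_closed_sets_def
proof (intro allI impI, elim conjE)
  fix D E assume D: "closedin X D" and E: "closedin X E" and DE: "disjnt D E"
  obtain f g where f: "homeomorphic_map X X' f" and g: "homeomorphic_map Y Y' g"
    and comm: "\<And>x. x \<in> topspace X \<Longrightarrow> g (e x) = e' (f x)"
    using iso unfolding Comp_isomorphic_def Comp_morphism_def by blast
  have DX: "D \<subseteq> topspace X" and EX: "E \<subseteq> topspace X"
    using D E by (auto simp: closedin_subset)
  have image: "g ` (Y closure_of (e ` S)) = Y' closure_of (e' ` f ` S)" if "S \<subseteq> topspace X" for S
  proof -
    have "e ` S \<subseteq> topspace Y"
      using that compactification_maps[OF e] by blast
    moreover have "g ` e ` S = e' ` f ` S"
      unfolding image_image using that comm by (intro image_cong) auto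
    ultimately show ?thesis
      using homeomorphic_map_closure_of[OF g] by metis
  qed
  have "closedin X' (f ` D)" "closedin X' (f ` E)"
    using D E DX EX homeomorphic_map_closedness[OF f] by blast+
  moreover have "disjnt (f ` D) (f ` E)"
    using DE DX EX homeomorphic_imp_injective_map[OF f]
    unfolding disjnt_iff by (auto dest: inj_onD)
  ultimately have "disjnt (Y' closure_of (e' ` f ` D)) (Y' closure_of (e' ` f ` E))"
    using sep by (simp add: separates_closed_sets_def)
  then show "disjnt (Y closure_of (e ` D)) (Y closure_of (e ` E))"
    unfolding image[OF DX, symmetric] image[OF EX, symmetric] by (auto simp: disjnt_iff)
qed

section \<open>The Stone-Cech compactification of a normal space\<close>

text \<open>
  The Tychonoff embedding of the library has the functions \<open>X \<rightarrow> [0,1]\<close> of a metric space of bounded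
  continuous functions as its coordinates; boundedness is automatic for them.
\<close>

lemma unit_interval_maps_eq_mspace:
  "unit_interval_maps X = mspace (submetric (cfunspace X euclidean_metric) {f. f \<in> topspace X \<rightarrow> {0..1}})"
proof -
  have "bounded (f ` topspace X)" if "f \<in> topspace X \<rightarrow> {0..1}" for f :: "'a \<Rightarrow> real"
    by (meson bounded_closed_interval bounded_subset image_subset_iff_funcset that)
  then show ?thesis
    by (auto simp: unit_interval_maps_def continuous_map_in_subtopology image_subset_iff_funcset)
qed

lemma compactification_stone_cech:
  assumes "completely_regular_space X" "Hausdorff_space X"
  shows "compactification X (\<beta> X) (stone_cech_map X)"
proof -
  let ?s = "stone_cech_map X" and ?Q = "stone_cech_cube X"
  have emb: "embedding_map X ?Q ?s"
    using completely_regular_space_cube_embedding_explicit[OF assms]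
    unfolding unit_interval_maps_eq_mspace[symmetric] stone_cech_cube_def stone_cech_map_def .
  have "compact_space ?Q" "Hausdorff_space ?Q"
    unfolding stone_cech_cube_def
    by (auto simp: compact_space_product_topology Hausdorff_space_product_topology compact_space_subtopology
        Hausdorff_space_subtopology)
  then have "compact_space (\<beta> X)" "Hausdorff_space (\<beta> X)"
    unfolding stone_cech_def
    by (simp_all add: compact_space_subtopology closedin_compact_space Hausdorff_space_subtopology)
  moreover have sub: "?s ` topspace X \<subseteq> ?Q closure_of (?s ` topspace X)"
    using emb by (intro closure_of_subset)
      (meson embedding_map_def continuous_map_in_subtopology continuous_map_image_subset_topspace
        homeomorphic_imp_continuous_map)
  moreover have "embedding_map X (\<beta> X) ?s"
    unfolding stone_cech_def embedding_map_in_subtopology using emb sub by blast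
  moreover have "\<beta> X closure_of (?s ` topspace X) = topspace (\<beta> X)"
    using sub closure_of_subset_topspace[of ?Q] unfolding stone_cech_def
    by (auto simp: closure_of_subtopology inf_absorb2)
  ultimately show ?thesis
    by (simp add: compactification_def)
qed

lemma continuous_map_stone_cech_component:
  assumes "f \<in> unit_interval_maps X"
  shows "continuous_map (\<beta> X) (top_of_set {0..1}) (\<lambda>p. p f)"
  unfolding stone_cech_def stone_cech_cube_def
  by (intro continuous_map_from_subtopology continuous_map_product_projection assms)

text \<open>
  A Urysohn function for the two sets extends to \<open>\<beta> X\<close> by the very construction of the cube: it is
  one of the coordinates, so the extension is a projection.
\<close>

lemma stone_cech_separates:
  assumes "normal_space X"
  shows "separates_closed_sets X (\<beta> X) (stone_cech_map X)"
  unfolding separates_closed_sets_def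
proof (intro allI impI, elim conjE)
  fix D E assume D: "closedin X D" and E: "closedin X E" and DE: "disjnt D E"
  obtain f where f: "continuous_map X (top_of_set {0..1::real}) f" "f ` D \<subseteq> {0}" "f ` E \<subseteq> {1}"
    using Urysohn_lemma[OF assms D E DE, of 0 1] by auto
  define f' where "f' = restrict f (topspace X)"
  have f': "f' \<in> unit_interval_maps X"
    using f(1) by (auto simp: unit_interval_maps_def f'_def intro: continuous_map_eq)
  \<comment> \<open>The Urysohn function is a coordinate of the cube, so its level sets on \<open>X\<close> stay inside closed
    level sets of that coordinate.\<close>
  have level: "\<beta> X closure_of (stone_cech_map X ` S) \<subseteq> {p. p f' = c}"
    if S: "S \<subseteq> topspace X" "f ` S \<subseteq> {c}" and c: "c \<in> {0..1}" for S c
  proof -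
    have "closedin (top_of_set {0..1::real}) {c}"
      using c by (simp add: closedin_Hausdorff_singleton Hausdorff_space_subtopology)
    then have "closedin (\<beta> X) {p \<in> topspace (\<beta> X). p f' \<in> {c}}"
      by (rule closedin_continuous_map_preimage[OF continuous_map_stone_cech_component[OF f']])
    moreover have "topspace (\<beta> X) \<inter> stone_cech_map X ` S \<subseteq> {p \<in> topspace (\<beta> X). p f' \<in> {c}}"
    proof -
      have "stone_cech_map X x f' = c" if "x \<in> S" for x
      proof -
        have "stone_cech_map X x f' = f x"
          using that S(1) f' by (auto simp: stone_cech_map_def f'_def)
        then show ?thesis
          using that S(2) by auto
      qed
      then show ?thesis
        by auto
    qed
    ultimately have "\<beta> X closure_of (topspace (\<beta> X) \<inter> stone_cech_map X ` S) \<subseteq> {p \<in> topspace (\<beta> X). p f' \<in> {c}}"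
      by (intro closure_of_minimal)
    then show ?thesis
      by (auto simp flip: closure_of_restrict)
  qed
  have "\<beta> X closure_of (stone_cech_map X ` D) \<subseteq> {p. p f' = 0}"
    "\<beta> X closure_of (stone_cech_map X ` E) \<subseteq> {p. p f' = 1}"
    using level f(2,3) closedin_subset[OF D] closedin_subset[OF E] by auto
  then show "disjnt (\<beta> X closure_of (stone_cech_map X ` D)) (\<beta> X closure_of (stone_cech_map X ` E))"
    by (fastforce simp: disjnt_iff)
qed

section \<open>Normal de Vries extensions and normal spaces\<close>

lemma normal_extension_iff_stone_cech:
  assumes X: "completely_regular_space X" "Hausdorff_space X"
    and e: "compactification X Y e"
  shows "normal_de_vries_extension (\<R>\<O> Y) (\<wp> (topspace X)) (preimage_map X e) \<longleftrightarrow>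
    normal_space X \<and> Comp_isomorphic X Y e X (\<beta> X) (stone_cech_map X)"
  unfolding normal_extension_iff_separates[OF e]
proof
  assume sep: "separates_closed_sets X Y e"
  have "normal_space X"
    by (rule separates_imp_normal_space[OF e sep])
  then show "normal_space X \<and> Comp_isomorphic X Y e X (\<beta> X) (stone_cech_map X)"
    using separating_compactifications_isomorphic[OF e sep compactification_stone_cech[OF X]]
      stone_cech_separates by blast
next
  assume "normal_space X \<and> Comp_isomorphic X Y e X (\<beta> X) (stone_cech_map X)"
  then show "separates_closed_sets X Y e"
    using Comp_isomorphic_separates[OF e] stone_cech_separates by blast
qed

theorem theorem3p2:
  fixes X :: "'a topology"
  assumes "completely_regular_space X" and "Hausdorff_space X"
  shows "(\<forall>(Y :: 'b topology) e. compactification X Y e \<longrightarrow>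
            (normal_de_vries_extension (\<R>\<O> Y) (\<wp> (topspace X)) (preimage_map X e) \<longleftrightarrow>
              normal_space X \<and> Comp_isomorphic X Y e X (\<beta> X) (stone_cech_map X)))
       \<and> (normal_space X \<longleftrightarrow>
            normal_de_vries_extension (\<R>\<O> (\<beta> X)) (\<wp> (topspace X))
              (preimage_map X (stone_cech_map X)))"
proof (intro conjI allI impI)
  fix Y :: "'b topology" and e
  assume "compactification X Y e"
  then show "normal_de_vries_extension (\<R>\<O> Y) (\<wp> (topspace X)) (preimage_map X e) \<longleftrightarrow>
      normal_space X \<and> Comp_isomorphic X Y e X (\<beta> X) (stone_cech_map X)"
    by (rule normal_extension_iff_stone_cech[OF assms])
next
  show "normal_space X \<longleftrightarrow>
      normal_de_vries_extension (\<R>\<O> (\<beta> X)) (\<wp> (topspace X)) (preimage_map X (stone_cech_map X))"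
    unfolding normal_extension_iff_separates[OF compactification_stone_cech[OF assms]]
    using separates_imp_normal_space[OF compactification_stone_cech[OF assms]] stone_cech_separates
    by blast
qed

end
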